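(* Let $G = \{G_1, \ldots, G_n\}$ with $n \ge 1$. Assume that $G_1 \equiv \{*L\}$ and that every option $G_j$ ($1 \le j \le n$) is a non-terminal position $G_j = \{G_{j1}, \ldots, G_{jm_j}\}$ having some option $G_{j\ell} \equiv *L$. Then $G \equiv *L$. Similarly, if $G_1 \equiv \{*R\}$ and every option $G_j = \{G_{j1}, \ldots, G_{jm_j}\}$ has some option $G_{j\ell} \equiv *R$, then $G \equiv *R$.
   Context: Positions are defined recursively: $*L$ and $*R$ are terminal positions; if $G_1,\dots,G_n$ ($n\ge 1$) are positions, then $\{G_1,\dots,G_n\}$ is a position with options $G_1,\dots,G_n$. All positions have finite game trees. Play: Left and Right move alternately, each choosing any option of the current position; when a terminal position is reached, Left wins if it is $*L$ and Right wins if it is $*R$. Disjunctive sum: $*L + *L = *R + *R = *L$, $*L + *R = *R + *L = *R$; if at least one of $G,H$ is non-terminal, $G+H$ has options all $G'+H$ ($G'$ an option of $G$) and all $G+H'$ ($H'$ an option of $H$). Outcome classes: $\mathcal{L}$ (Left wins moving first or second), $\mathcal{R}$ (Right wins moving first or second), $\mathcal{N}$ (first player wins), $\mathcal{P}$ (second player wins); $o(G)$ denotes the outcome class. Equivalence: $G \equiv H$ iff $o(G+X) = o(H+X)$ for every position $X$. *)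

theory Defs
  imports "HOL-Library.FSet"
begin

text \<open>The datatype also contains nodes without options; the predicate \<open>is_position\<close> singles out
  the positions, in which every non-terminal node has at least one option.\<close>

datatype position = StarL | StarR | Node "position fset"

fun opts :: "position \<Rightarrow> position fset" where
  "opts StarL = {||}"
| "opts StarR = {||}"
| "opts (Node Gs) = Gs"

inductive is_position :: "position \<Rightarrow> bool" where
  "is_position StarL"
| "is_position StarR"
| "Gs \<noteq> {||} \<Longrightarrow> (\<And>G. G |\<in>| Gs \<Longrightarrow> is_position G) \<Longrightarrow> is_position (Node Gs)"

lemma size_opts: "G' |\<in>| opts G \<Longrightarrow> size G' < size G"
proof (cases G)
  case (Node Gs)
  assume "G' |\<in>| opts G"
  then have "G' \<in> fset Gs" using Node by simp
  then have "Suc (size G') \<le> (\<Sum>x\<in>fset Gs. Suc (size x))"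
    by (intro member_le_sum) auto
  then show ?thesis using Node by simp
qed auto

function gsum :: "position \<Rightarrow> position \<Rightarrow> position"  (infixl \<open>\<oplus>\<close> 65) where
  "StarL \<oplus> StarL = StarL"
| "StarR \<oplus> StarR = StarL"
| "StarL \<oplus> StarR = StarR"
| "StarR \<oplus> StarL = StarR"
| "Node Gs \<oplus> H =
     Node ((\<lambda>G'. G' \<oplus> H) |`| Gs |\<union>| (\<lambda>H'. Node Gs \<oplus> H') |`| opts H)"
| "StarL \<oplus> Node Hs = Node ((\<lambda>H'. StarL \<oplus> H') |`| Hs)"
| "StarR \<oplus> Node Hs = Node ((\<lambda>H'. StarR \<oplus> H') |`| Hs)"
  by pat_completeness auto
termination
  by (relation "measure (\<lambda>(G, H). size G + size H)")
    (use size_opts[of _ "Node _"] size_opts in \<open>auto simp del: position.size\<close>)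

lemma gsum_nonterminal:
  assumes "G \<notin> {StarL, StarR} \<or> H \<notin> {StarL, StarR}"
  shows "G \<oplus> H = Node ((\<lambda>G'. G' \<oplus> H) |`| opts G |\<union>| (\<lambda>H'. G \<oplus> H') |`| opts H)"
  using assms by (cases G; cases H) auto

lemma is_position_gsum: "is_position G \<Longrightarrow> is_position H \<Longrightarrow> is_position (G \<oplus> H)"
proof (induction G H rule: gsum.induct)
  case (5 Gs H)
  from \<open>is_position (Node Gs)\<close> have "Gs \<noteq> {||}" "\<And>G. G |\<in>| Gs \<Longrightarrow> is_position G"
    by (auto elim: is_position.cases)
  moreover have "\<And>H'. H' |\<in>| opts H \<Longrightarrow> is_position H'"
    using \<open>is_position H\<close> by (auto elim: is_position.cases)
  ultimately show ?case using 5 by (auto intro!: is_position.intros)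
qed (auto intro!: is_position.intros elim: is_position.cases)

datatype player = Left | Right

fun opponent :: "player \<Rightarrow> player" where
  "opponent Left = Right"
| "opponent Right = Left"

text \<open>\<open>wins a p G\<close>: player \<open>a\<close> has a winning strategy on \<open>G\<close> when player \<open>p\<close> is the next to move.\<close>

function wins :: "player \<Rightarrow> player \<Rightarrow> position \<Rightarrow> bool" where
  "wins a p StarL \<longleftrightarrow> a = Left"
| "wins a p StarR \<longleftrightarrow> a = Right"
| "wins a p (Node Gs) \<longleftrightarrow>
     (if p = a then \<exists>G|\<in>|Gs. wins a (opponent p) G
      else \<forall>G|\<in>|Gs. wins a (opponent p) G)"
  by pat_completeness auto
termination
  by (relation "measure (\<lambda>(a, p, G). size G)")
    (use size_opts[of _ "Node _"] in \<open>auto simp del: position.size\<close>)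

lemma wins_Right_iff: "wins Right p G \<longleftrightarrow> \<not> wins Left p G"
proof (induction G arbitrary: p)
  case (Node Gs)
  then show ?case by (cases p) auto
qed auto

datatype outcome_class = \<L> | \<R> | \<N> | \<P>

definition outcome :: "position \<Rightarrow> outcome_class" where
  "outcome G =
     (if wins Left Left G \<and> wins Left Right G then \<L>
      else if wins Right Left G \<and> wins Right Right G then \<R>
      else if wins Left Left G \<and> wins Right Right G then \<N>
      else \<P>)"

lemma outcome_iff:
  "outcome G = \<L> \<longleftrightarrow> wins Left Left G \<and> wins Left Right G"
  "outcome G = \<R> \<longleftrightarrow> wins Right Left G \<and> wins Right Right G"
  "outcome G = \<N> \<longleftrightarrow> wins Left Left G \<and> wins Right Right G"
  "outcome G = \<P> \<longleftrightarrow> wins Right Left G \<and> wins Left Right G"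
  by (auto simp: outcome_def wins_Right_iff)

definition equivalent :: "position \<Rightarrow> position \<Rightarrow> bool"  (infix \<open>\<approx>\<close> 50) where
  "G \<approx> H \<longleftrightarrow> (\<forall>X. is_position X \<longrightarrow> outcome (G \<oplus> X) = outcome (H \<oplus> X))"

end

theory Submission imports Defs begin

text \<open>Write \<open>T\<close> for the terminal position \<open>*L\<close> or \<open>*R\<close> in question. Whoever wins \<open>T + X\<close> also wins
  \<open>G + X\<close> with the same player to move, by induction on \<open>X\<close>: the winner follows the strategy for
  \<open>T + X\<close> and answers any move of the opponent in \<open>G\<close> by reverting that component to a position
  equivalent to \<open>T\<close>. Only when \<open>X\<close> is terminal can the winner be forced to move in \<open>G\<close>; then the
  option \<open>G\<^sub>1 \<equiv> {T}\<close> leaves the opponent with nothing but the move to \<open>T + X\<close>. As exactly one player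
  wins, the outcomes agree.\<close>

lemma opponent_neq [simp]: "opponent a \<noteq> a" "a \<noteq> opponent a"
  by (cases a; simp)+

lemma opponent_opponent [simp]: "opponent (opponent a) = a"
  by (cases a) simp_all

lemma neq_player_iff: "p \<noteq> a \<longleftrightarrow> p = opponent a"
  by (cases p; cases a) simp_all

lemma wins_opponent_iff: "wins (opponent a) p G \<longleftrightarrow> \<not> wins a p G"
  by (cases a) (simp_all add: wins_Right_iff)

text \<open>The fifth equation of \<open>gsum\<close> needs no case split on \<open>X\<close>, so
  the moves divide into those in \<open>Gs\<close> and those in \<open>X\<close> even for terminal
  \<open>X\<close>.\<close>

lemma wins_gsum_self:
  "wins a a (Node Gs \<oplus> X) \<longleftrightarrow>
    (\<exists>G|\<in>|Gs. wins a (opponent a) (G \<oplus> X)) \<or> (\<exists>X'|\<in>|opts X. wins a (opponent a) (Node Gs \<oplus> X'))"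
  by (subst gsum.simps(5)) (auto simp del: gsum.simps)

lemma wins_gsum_opponent:
  "wins a (opponent a) (Node Gs \<oplus> X) \<longleftrightarrow>
    (\<forall>G|\<in>|Gs. wins a a (G \<oplus> X)) \<and> (\<forall>X'|\<in>|opts X. wins a a (Node Gs \<oplus> X'))"
  by (subst gsum.simps(5)) (auto simp del: gsum.simps)

text \<open>Exactly one player wins for each choice of starter, so the four classes encode the four
  possible pairs of winners.\<close>

lemma outcome_eq_iff: "outcome G = outcome H \<longleftrightarrow> (\<forall>a p. wins a p G = wins a p H)"
proof
  assume eq: "outcome G = outcome H"
  have "wins Left p G = wins Left p H" for p
    using eq by (cases p) (auto simp: outcome_def wins_Right_iff split: if_splits)
  then have "wins a p G = wins a p H" for a p
    by (cases a) (simp_all add: wins_Right_iff)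
  then show "\<forall>a p. wins a p G = wins a p H" by blast
qed (simp add: outcome_def)

lemma equivalent_iff_wins:
  "G \<approx> H \<longleftrightarrow> (\<forall>X. is_position X \<longrightarrow> (\<forall>a p. wins a p (G \<oplus> X) = wins a p (H \<oplus> X)))"
  by (simp add: equivalent_def outcome_eq_iff)

lemma is_position_opts: "is_position G \<Longrightarrow> G' |\<in>| opts G \<Longrightarrow> is_position G'"
  by (auto elim: is_position.cases)

lemma wins_gsum_if_wins_terminal_gsum:
  assumes T: "T \<in> {StarL, StarR}"
    and G1: "G1 |\<in>| Gs" "G1 \<approx> Node {|T|}"
    and revert: "\<forall>Gj|\<in>|Gs. \<exists>Hs. Gj = Node Hs \<and> (\<exists>H|\<in>|Hs. H \<approx> T)"
    and "is_position X" "wins a p (T \<oplus> X)"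
  shows "wins a p (Node Gs \<oplus> X)"
  using assms(5,6)
proof (induction "size X" arbitrary: X p rule: less_induct)
  case less
  have IH: "wins a q (Node Gs \<oplus> X')" if "X' |\<in>| opts X" "wins a q (T \<oplus> X')" for X' q
    using less.hyps[OF size_opts] is_position_opts[OF less.prems(1)] that by blast
  show ?case
  proof (cases "p = a")
    case True
    have "(\<exists>G'|\<in>|Gs. wins a (opponent a) (G' \<oplus> X)) \<or>
          (\<exists>X'|\<in>|opts X. wins a (opponent a) (Node Gs \<oplus> X'))"
    proof (cases "X \<in> {StarL, StarR}")
      case terminal: True
      then have "opts X = {||}" by auto
      \<comment> \<open>The only move in this sum leads to \<open>T \<oplus> X\<close> with
        \<open>a\<close> to move, which \<open>a\<close> wins by assumption.\<close>
      then have "wins a (opponent a) (Node {|T|} \<oplus> X)"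
        using less.prems(2) True by (simp add: wins_gsum_opponent del: gsum.simps)
      then have "wins a (opponent a) (G1 \<oplus> X)"
        using G1(2) less.prems(1) by (simp add: equivalent_iff_wins del: gsum.simps)
      then show ?thesis using G1(1) by blast
    next
      case False
      then have "T \<oplus> X = Node ((\<lambda>X'. T \<oplus> X') |`| opts X)"
        using T by (cases X) auto
      then obtain X' where "X' |\<in>| opts X" "wins a (opponent a) (T \<oplus> X')"
        using less.prems(2) True by (auto simp del: gsum.simps)
      then show ?thesis using IH by blast
    qed
    then show ?thesis unfolding True wins_gsum_self .
  next
    case False
    then have p: "p = opponent a" by (simp add: neq_player_iff)
    have "wins a a (G' \<oplus> X)" if G': "G' |\<in>| Gs" for G'
    proof -
      obtain Hs H where H: "G' = Node Hs" "H |\<in>| Hs" "H \<approx> T"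
        using revert G' by blast
      \<comment> \<open>Moving from \<open>G'\<close> to \<open>H\<close> hands the turn back to the
        opponent, and \<open>H \<oplus> X\<close> has the same winner as
        \<open>T \<oplus> X\<close>.\<close>
      then have "wins a (opponent a) (H \<oplus> X)"
        using less.prems p by (simp add: equivalent_iff_wins del: gsum.simps)
      then show ?thesis using H(2) unfolding H(1) wins_gsum_self by blast
    qed
    moreover have "wins a a (Node Gs \<oplus> X')" if "X' |\<in>| opts X" for X'
    proof -
      \<comment> \<open>\<open>X\<close> has an option, so it is non-terminal and every move in
        \<open>T \<oplus> X\<close> is a move in \<open>X\<close>.\<close>
      have "T \<oplus> X = Node ((\<lambda>X'. T \<oplus> X') |`| opts X)"
        using T that by (cases X) auto
      then have "wins a a (T \<oplus> X')"
        using less.prems(2) p that by (simp del: gsum.simps)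
      then show ?thesis using IH that by blast
    qed
    ultimately show ?thesis unfolding p wins_gsum_opponent by blast
  qed
qed

lemma equivalent_terminal:
  assumes "T \<in> {StarL, StarR}" "G1 |\<in>| Gs" "G1 \<approx> Node {|T|}"
    and "\<forall>Gj|\<in>|Gs. \<exists>Hs. Gj = Node Hs \<and> (\<exists>H|\<in>|Hs. H \<approx> T)"
  shows "Node Gs \<approx> T"
  unfolding equivalent_iff_wins
proof (intro allI impI)
  fix X a p
  assume X: "is_position X"
  show "wins a p (Node Gs \<oplus> X) = wins a p (T \<oplus> X)"
    \<comment> \<open>The instance for \<open>opponent a\<close> gives the converse by
      contraposition.\<close>
    using wins_gsum_if_wins_terminal_gsum[OF assms X, of a p]
      wins_gsum_if_wins_terminal_gsum[OF assms X, of "opponent a" p]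
    unfolding wins_opponent_iff by blast
qed

theorem theorem3p9:
  fixes Gs :: "position fset" and G1 :: position
  assumes "is_position (Node Gs)" and "G1 |\<in>| Gs"
  shows "(G1 \<approx> Node {|StarL|} \<and>
          (\<forall>Gj|\<in>|Gs. (\<exists>Hs. Gj = Node Hs \<and> (\<exists>H|\<in>|Hs. H \<approx> StarL)))
          \<longrightarrow> Node Gs \<approx> StarL) \<and>
         (G1 \<approx> Node {|StarR|} \<and>
          (\<forall>Gj|\<in>|Gs. (\<exists>Hs. Gj = Node Hs \<and> (\<exists>H|\<in>|Hs. H \<approx> StarR)))
          \<longrightarrow> Node Gs \<approx> StarR)"
  using equivalent_terminal[of StarL, OF _ assms(2)] equivalent_terminal[of StarR, OF _ assms(2)]
  by simp

end
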